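(* There is no real number $x$ for which Reduce-Fastest$(x)$ achieves backlog $2.01$: for every real $x$ there exist $n \in \mathbb{N}$ and growth rates $h_1,\dots,h_n>0$ with $\sum_i h_i = 1$ such that, in the bamboo trimming process run with Reduce-Fastest$(x)$, some bamboo reaches height greater than $2.01$.
   Context: Bamboo trimming problem: bamboo $b_1,\dots,b_n$ with growth rates $h_i>0$, all starting at height $0$; each time step consists of every $b_i$ growing by $h_i$, after which the algorithm cuts at most one bamboo to height $0$. Reduce-Fastest$(x)$: after the growth phase of each step, among bamboo with height at least $x$, cut one with the largest growth rate (ties broken arbitrarily); if none has height at least $x$, cut nothing. The backlog is the maximum height ever reached by any bamboo, including immediately after growth and before the cut. *)

theory Defs
  imports Complex_Main
begin

text \<open>
  The bamboos are indexed by \<open>{1..n}\<close>, \<open>h i\<close> is the growth rate of bamboo \<open>i\<close>, and a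
  height vector is a function \<open>nat \<Rightarrow> real\<close> of which only the values on \<open>{1..n}\<close> matter.
\<close>

definition grow :: "(nat \<Rightarrow> real) \<Rightarrow> (nat \<Rightarrow> real) \<Rightarrow> nat \<Rightarrow> real" where
  "grow h a = (\<lambda>i. a i + h i)"

definition apply_cut :: "nat option \<Rightarrow> (nat \<Rightarrow> real) \<Rightarrow> nat \<Rightarrow> real" where
  "apply_cut c a = (case c of None \<Rightarrow> a | Some j \<Rightarrow> a(j := 0))"

text \<open>
  The cuts that Reduce-Fastest with threshold \<open>x\<close> may make when the heights after the growth
  phase are \<open>a\<close>. This is a relation because ties among growth rates may be broken in any way.
\<close>

definition reduce_fastest_choice ::
    "real \<Rightarrow> nat \<Rightarrow> (nat \<Rightarrow> real) \<Rightarrow> (nat \<Rightarrow> real) \<Rightarrow> nat option \<Rightarrow> bool" where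
  "reduce_fastest_choice x n h a c \<longleftrightarrow>
     (case c of
        None \<Rightarrow> \<forall>i\<in>{1..n}. a i < x
      | Some j \<Rightarrow> j \<in> {1..n} \<and> a j \<ge> x \<and> (\<forall>i\<in>{1..n}. a i \<ge> x \<longrightarrow> h i \<le> h j))"

text \<open>
  \<open>H t i\<close> is the height of bamboo \<open>i\<close> at the end of step \<open>t\<close> (after the cut), with
  \<open>H 0\<close> the initial heights. The choice may differ from step to step, so tie-breaking is
  allowed to depend on the whole history.
\<close>

definition reduce_fastest_run ::
    "real \<Rightarrow> nat \<Rightarrow> (nat \<Rightarrow> real) \<Rightarrow> (nat \<Rightarrow> nat \<Rightarrow> real) \<Rightarrow> bool" where
  "reduce_fastest_run x n h H \<longleftrightarrow>
     (\<forall>i\<in>{1..n}. H 0 i = 0) \<and>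
     (\<forall>t. \<exists>c. reduce_fastest_choice x n h (grow h (H t)) c \<and>
              (\<forall>i\<in>{1..n}. H (Suc t) i = apply_cut c (grow h (H t)) i))"

definition reached_heights :: "(nat \<Rightarrow> real) \<Rightarrow> (nat \<Rightarrow> nat \<Rightarrow> real) \<Rightarrow> nat \<Rightarrow> real set" where
  "reached_heights h H i = (\<Union>t. {H t i, grow h (H t) i})"

lemma reduce_fastest_choice_exists: "\<exists>c. reduce_fastest_choice x n h a c"
proof (cases "\<exists>i\<in>{1..n}. a i \<ge> x")
  case False
  then have "reduce_fastest_choice x n h a None"
    by (auto simp: reduce_fastest_choice_def not_le)
  then show ?thesis ..
next
  case True
  let ?S = "{i \<in> {1..n}. a i \<ge> x}"
  have "finite (h ` ?S)" "h ` ?S \<noteq> {}"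
    using True by auto
  then have "Max (h ` ?S) \<in> h ` ?S" and max: "\<forall>y\<in>h ` ?S. y \<le> Max (h ` ?S)"
    by (blast intro: Max_in Max_ge)+
  then obtain j where "j \<in> ?S" "h j = Max (h ` ?S)"
    by auto
  with max have "reduce_fastest_choice x n h a (Some j)"
    by (auto simp: reduce_fastest_choice_def)
  then show ?thesis ..
qed

text \<open>Runs always exist, so a claim about all runs is never vacuous.\<close>

lemma reduce_fastest_run_exists: "\<exists>H. reduce_fastest_run x n h H"
proof -
  define step where
    "step a = apply_cut (SOME c. reduce_fastest_choice x n h (grow h a) c) (grow h a)" for a
  have "reduce_fastest_run x n h (\<lambda>t. (step ^^ t) (\<lambda>_. 0))"
    unfolding reduce_fastest_run_def
    using someI_ex[OF reduce_fastest_choice_exists] by (fastforce simp: step_def)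
  then show ?thesis by blast
qed

end

theory Submission
  imports Defs
begin

text \<open>
  If \<open>x < 1\<close>, a bamboo of rate at least \<open>x\<close> is cut in every step and a slower one starves.
  If \<open>x \<ge> 1.1\<close>, take \<open>n\<close> bamboos of equal rate: they all reach \<open>x\<close> simultaneously, and the last
  one to be cut waits for another \<open>n - 1\<close> steps, so that it reaches about \<open>x + 1\<close>.
  If \<open>1 \<le> x \<le> 1.1\<close>, take \<open>m\<close> fast bamboos of rate \<open>x / p\<close> and \<open>k\<close> slightly slower ones, where
  \<open>p = m + k - 1\<close>. The fast ones occupy the steps \<open>p, \<dots>, p + m - 1\<close>, and by periodicity
  also the steps \<open>2 p, \<dots>, 2 p + m - 1\<close>. Only the \<open>p - m = k - 1\<close> steps in between are left for the
  \<open>k\<close> slow ones, so one of these is still uncut after \<open>2 p + m\<close> growth phases; with \<open>m\<close> around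
  half of the bamboos it has height about \<open>2.5\<close> for \<open>x = 1\<close>.
\<close>

text \<open>
  Below, steps are numbered from \<open>0\<close> (unlike in the sketch above): \<open>c t\<close> is the cut that leads
  from \<open>H t\<close> to \<open>H (Suc t)\<close>.
\<close>

locale reduce_fastest =
  fixes x :: real and n :: nat and h :: "nat \<Rightarrow> real" and H :: "nat \<Rightarrow> nat \<Rightarrow> real"
    and c :: "nat \<Rightarrow> nat option"
  assumes rate_pos: "i \<in> {1..n} \<Longrightarrow> h i > 0"
    and init: "i \<in> {1..n} \<Longrightarrow> H 0 i = 0"
    and choice: "reduce_fastest_choice x n h (grow h (H t)) (c t)"
    and step: "i \<in> {1..n} \<Longrightarrow> H (Suc t) i = apply_cut (c t) (grow h (H t)) i"
begin

section \<open>Heights and cut times along a run\<close>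

lemma height_Suc:
  assumes "i \<in> {1..n}"
  shows "H (Suc t) i = (if c t = Some i then 0 else H t i + h i)"
  using step[OF assms, of t] by (auto simp: apply_cut_def grow_def split: option.splits)

lemma cut_ge_threshold:
  assumes "c t = Some i"
  shows "i \<in> {1..n}" "H t i + h i \<ge> x"
  using choice[of t] assms by (auto simp: reduce_fastest_choice_def grow_def)

lemma cut_fastest:
  assumes "i \<in> {1..n}" "H t i + h i \<ge> x"
  obtains j where "c t = Some j" "j \<in> {1..n}" "h j \<ge> h i"
proof (cases "c t")
  case None
  then show ?thesis
    using choice[of t] assms by (force simp: reduce_fastest_choice_def grow_def)
next
  case (Some j)
  then show ?thesis
    using choice[of t] assms that by (auto simp: reduce_fastest_choice_def grow_def)
qed

lemma height_le:
  assumes "i \<in> {1..n}"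
  shows "H t i \<le> real t * h i"
proof (induction t)
  case 0
  then show ?case using init[OF assms] by simp
next
  case (Suc t)
  have "real t * h i \<ge> 0" using rate_pos[OF assms] by simp
  with Suc rate_pos[OF assms] show ?case
    by (simp add: height_Suc[OF assms] algebra_simps)
qed

lemma cut_time:
  assumes "c t = Some i"
  shows "real (Suc t) * h i \<ge> x"
  using cut_ge_threshold[OF assms] height_le[of i t] by (simp add: algebra_simps)

lemma height_uncut:
  assumes "i \<in> {1..n}" "\<And>s. s < t \<Longrightarrow> c s \<noteq> Some i"
  shows "H t i = real t * h i"
  using assms(2)
proof (induction t)
  case 0
  then show ?case using init[OF assms(1)] by simp
next
  case (Suc t)
  then show ?case by (simp add: height_Suc[OF assms(1)] algebra_simps)
qed

text \<open>Pigeonhole: each step cuts at most one bamboo, so the steps in \<open>S\<close> cannot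
  account for all of \<open>I\<close>. A step without a cut only adds the arbitrary value
  \<open>the None\<close> to the image, which does not affect the cardinality bound.\<close>

lemma exists_uncut:
  assumes "I \<subseteq> {1..n}" "finite S" "card S < card I"
    and S: "\<And>s i. s < t \<Longrightarrow> i \<in> I \<Longrightarrow> c s = Some i \<Longrightarrow> s \<in> S"
  obtains i where "i \<in> I" "H t i = real t * h i"
proof -
  have "card ((the \<circ> c) ` S) < card I"
    using card_image_le[OF assms(2), of "the \<circ> c"] assms(3) by simp
  then have "\<not> I \<subseteq> (the \<circ> c) ` S"
    using card_mono[of "(the \<circ> c) ` S" I] assms(2) by auto
  then obtain i where i: "i \<in> I" "i \<notin> (the \<circ> c) ` S" by blast
  have "c s \<noteq> Some i" if "s < t" for s
    using S[OF that i(1)] i(2) by force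
  with height_uncut[of i t] i(1) assms(1) that show ?thesis by blast
qed

lemma reached_heights_grow: "H t i + h i \<in> reached_heights h H i"
  by (auto simp: reached_heights_def grow_def)

section \<open>Starvation and equal rates\<close>

lemma starvation:
  assumes "i \<in> {1..n}" "j \<in> {1..n}" "h i < h j" "h j \<ge> x"
  shows "\<exists>z\<in>reached_heights h H i. z > y"
proof -
  have "h i > 0" using rate_pos assms(1) by blast
  \<comment> \<open>Heights never become negative, so \<open>j\<close> meets the threshold after
    every growth phase and always blocks the slower \<open>i\<close>.\<close>
  have "H t j \<ge> 0" for t
    using rate_pos[OF assms(2)] init[OF assms(2)]
    by (induction t) (auto simp: height_Suc[OF assms(2)])
  then have "H t j + h j \<ge> x" for t
    using assms(4) by (simp add: add_increasing)
  then have "c t \<noteq> Some i" for t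
    using cut_fastest[OF assms(2), of t] assms(3) by (metis linorder_not_le option.inject)
  then have H: "H t i = real t * h i" for t
    using height_uncut[OF assms(1)] by blast
  obtain t where "y < real t * h i"
    using \<open>h i > 0\<close> reals_Archimedean3 by blast
  then have "H t i + h i > y"
    using H[of t] \<open>h i > 0\<close> by simp
  then show ?thesis using reached_heights_grow by blast
qed

lemma equal_rates:
  assumes "n > 0" "\<And>i. i \<in> {1..n} \<Longrightarrow> h i = 1 / n" "x \<ge> 1"
  shows "\<exists>i\<in>{1..n}. \<exists>y\<in>reached_heights h H i. y \<ge> x + 1 - 1 / n"
proof -
  \<comment> \<open>A rate of \<open>1 / n\<close> needs \<open>p\<close> growth phases to reach
    \<open>x\<close>. With steps numbered from 0, no cut precedes step \<open>p - 1\<close>, so at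
    most \<open>n - 1\<close> bamboos are cut before step \<open>p + n - 2\<close>.\<close>
  define p where "p = nat \<lceil>n * x\<rceil>"
  have "n * x \<ge> 1"
    using assms(1,3) mult_mono[of 1 "real n" 1 x] by simp
  then have p: "p \<ge> 1" "real p \<ge> n * x"
    unfolding p_def by linarith+
  have "card {p - 1..<p + n - 2} < card {1..n}"
    using assms(1) p by simp
  moreover have "s \<in> {p - 1..<p + n - 2}" if "s < p + n - 2" "c s = Some i" for s i
  proof -
    have "h i = 1 / n" using cut_ge_threshold(1)[OF that(2)] assms(2) by blast
    with cut_time[OF that(2)] assms(1) have "real (Suc s) \<ge> n * x"
      by (simp add: field_simps)
    then have "Suc s \<ge> p" unfolding p_def by linarith
    with that show ?thesis by simp
  qed
  ultimately obtain i where i: "i \<in> {1..n}" "H (p + n - 2) i = real (p + n - 2) * h i"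
    using exists_uncut[of "{1..n}" "{p - 1..<p + n - 2}" "p + n - 2"] by blast
  have "real (p + n - 2) = real p + real n - 2"
    using assms(1) p by (simp add: of_nat_diff)
  with i assms(1,2) have "H (p + n - 2) i + h i = (real p + real n - 1) / n"
    by (simp add: field_simps)
  also have "\<dots> \<ge> (n * x + real n - 1) / n"
    using p by (simp add: divide_right_mono)
  also have "(n * x + real n - 1) / n = x + 1 - 1 / n"
    using assms(1) by (simp add: field_simps)
  finally show ?thesis
    using i(1) reached_heights_grow by blast
qed

section \<open>Two growth rates\<close>

context
  fixes m k p :: nat and a b :: real
  assumes n_eq: "n = m + k" and rates: "a > b" "b > 0" and p_pos: "p > 0" and p_rate: "p * a = x"
    and fast: "\<And>i. i \<in> {1..m} \<Longrightarrow> h i = a"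
    and slow: "\<And>i. i \<in> {m + 1..m + k} \<Longrightarrow> h i = b"
begin

lemma fast_priority:
  assumes "i \<in> {1..m}" "H t i + a \<ge> x"
  shows "c t \<in> Some ` {1..m}"
proof -
  obtain j where j: "c t = Some j" "j \<in> {1..n}" "h j \<ge> a"
    using cut_fastest[of i t] assms fast n_eq by auto
  with slow[of j] rates(1) n_eq have "j \<in> {1..m}"
    by (cases "j \<le> m") auto
  with j(1) show ?thesis by blast
qed

lemma no_early_cut:
  assumes "c t = Some i"
  shows "p \<le> Suc t"
proof -
  have "h i \<le> a"
    using cut_ge_threshold(1)[OF assms] fast[of i] slow[of i] rates(1) n_eq
    by (cases "i \<le> m") auto
  then have "real (Suc t) * h i \<le> real (Suc t) * a"
    by (intro mult_left_mono) auto
  then have "real p * a \<le> real (Suc t) * a"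
    using cut_time[OF assms] p_rate by linarith
  then show ?thesis
    using rates by (simp add: mult_le_cancel_right)
qed

text \<open>Cuts start no earlier than step \<open>p - 1\<close>, so fewer than \<open>m\<close> of
  them precede step \<open>t\<close>. Some fast bamboo is thus still uncut and, after at least
  \<open>p\<close> growth phases, has reached \<open>p * a = x\<close>.\<close>

lemma first_fast_burst:
  assumes "p \<le> Suc t" "Suc t < p + m"
  shows "c t \<in> Some ` {1..m}"
proof -
  have "card {p - 1..<t} < card {1..m}"
    using assms p_pos by auto
  moreover have "s \<in> {p - 1..<t}" if "s < t" "c s = Some i" for s i
    using no_early_cut[OF that(2)] that(1) by auto
  ultimately obtain i where i: "i \<in> {1..m}" "H t i = real t * h i"
    using exists_uncut[of "{1..m}" "{p - 1..<t}" t] n_eq by auto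
  have "H t i + a = real (Suc t) * a"
    using i fast by (simp add: algebra_simps)
  also have "\<dots> \<ge> p * a"
    using assms(1) rates by (intro mult_right_mono) auto
  finally show ?thesis
    using fast_priority i(1) p_rate by blast
qed

text \<open>Because \<open>p * a\<close> equals \<open>x\<close> without rounding, a fast bamboo cut
  at step \<open>t\<close> is below the threshold for the next \<open>p - 1\<close> steps and meets
  it exactly at step \<open>t + p\<close>. The cut made then may go to another fast bamboo, but not
  to a slow one.\<close>

lemma fast_periodic:
  assumes "c t \<in> Some ` {1..m}"
  shows "c (t + p) \<in> Some ` {1..m}"
proof -
  obtain i where i: "c t = Some i" "i \<in> {1..m}" using assms by auto
  then have "i \<in> {1..n}" "h i = a" using fast n_eq by auto
  have H: "H (Suc t + d) i = d * a" if "d < p" for d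
    using that
  proof (induction d)
    case 0
    then show ?case using height_Suc[OF \<open>i \<in> {1..n}\<close>, of t] i(1) by simp
  next
    case (Suc d)
    then have IH: "H (Suc t + d) i + a = real (Suc d) * a" by (simp add: algebra_simps)
    also have "\<dots> < p * a"
      using Suc.prems rates by (intro mult_strict_right_mono) auto
    finally have "c (Suc t + d) \<noteq> Some i"
      using cut_ge_threshold(2)[of "Suc t + d" i] \<open>h i = a\<close> p_rate by fastforce
    then show ?case
      using height_Suc[OF \<open>i \<in> {1..n}\<close>, of "Suc t + d"] IH \<open>h i = a\<close> by simp
  qed
  have "H (t + p) i + a = real (Suc (p - 1)) * a"
    using H[of "p - 1"] p_pos by (simp add: algebra_simps)
  then have "H (t + p) i + a = x"
    using p_pos p_rate by simp
  then show ?thesis using fast_priority[OF i(2)] by simp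
qed

lemma two_rates:
  assumes "p < m + k" "m \<le> p"
  shows "\<exists>i\<in>{1..n}. (2 * real p + m) * b \<in> reached_heights h H i"
proof -
  define T where "T = 2 * p + m - 1"
  \<comment> \<open>Between the two bursts of fast cuts there are \<open>p - m\<close> steps, fewer
    than \<open>k\<close>.\<close>
  have "card {p + m - 1..<2 * p - 1} < card {m + 1..m + k}"
    using assms p_pos by auto
  moreover have "s \<in> {p + m - 1..<2 * p - 1}"
    if "s < T" "i \<in> {m + 1..m + k}" "c s = Some i" for s i
  proof (rule ccontr)
    have not_fast: "c s \<notin> Some ` {1..m}" using that by auto
    assume "\<not> ?thesis"
    then consider "Suc s < p + m" | "2 * p \<le> Suc s" by force
    then show False
    proof cases
      case 1
      then show False using first_fast_burst[of s] no_early_cut[OF that(3)] not_fast by blast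
    next
      case 2
      \<comment> \<open>Here \<open>s - p\<close> lies in the first burst, so \<open>s\<close> lies
        in its repetition one period later.\<close>
      then show False
        using first_fast_burst[of "s - p"] fast_periodic[of "s - p"] not_fast that(1) p_pos
        by (auto simp: T_def)
    qed
  qed
  ultimately obtain i where i: "i \<in> {m + 1..m + k}" "H T i = real T * h i"
    using exists_uncut[of "{m + 1..m + k}" "{p + m - 1..<2 * p - 1}" T] n_eq by auto
  have "H T i + h i = real (Suc T) * b"
    using i slow by (simp add: algebra_simps)
  also have "real (Suc T) = 2 * real p + m"
    using p_pos by (simp add: T_def)
  finally show ?thesis
    using i(1) n_eq reached_heights_grow[of T i] by (intro bexI[of _ i]) auto
qed

end

end

section \<open>Instances for the three ranges of the threshold\<close>

lemma reduce_fastest_run_locale: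
  assumes "reduce_fastest_run x n h H" "\<And>i. i \<in> {1..n} \<Longrightarrow> h i > 0"
  obtains c where "reduce_fastest x n h H c"
proof -
  from assms(1) obtain c where "\<forall>t. reduce_fastest_choice x n h (grow h (H t)) (c t) \<and>
      (\<forall>i\<in>{1..n}. H (Suc t) i = apply_cut (c t) (grow h (H t)) i)"
    unfolding reduce_fastest_run_def by metis
  with assms that[of c] show ?thesis
    by (auto simp: reduce_fastest_def reduce_fastest_run_def)
qed

theorem theorem3p4:
  fixes x :: real
  shows "\<exists>(n::nat) (h :: nat \<Rightarrow> real).
           (\<forall>i\<in>{1..n}. h i > 0) \<and> (\<Sum>i=1..n. h i) = 1 \<and>
           (\<forall>H. reduce_fastest_run x n h H \<longrightarrow>
                (\<exists>i\<in>{1..n}. \<exists>y\<in>reached_heights h H i. y > 2.01))"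
proof -
  consider "x < 1" | "1 \<le> x" "x \<le> 1.1" | "1.1 \<le> x" by linarith
  then show ?thesis
  proof cases
    case 1
    \<comment> \<open>The bound \<open>2/3\<close> keeps bamboo 1 strictly faster than bamboo 2 when
      \<open>x\<close> is small or negative.\<close>
    define h where "h i = (if i = 1 then max x (2/3) else 1 - max x (2/3))" for i :: nat
    have pos: "h i > 0" for i
      using 1 by (auto simp: h_def)
    have "{1..2::nat} = {1, 2}" by auto
    then have sum: "(\<Sum>i=1..2. h i) = 1" by (simp add: h_def)
    have "\<exists>i\<in>{1..2}. \<exists>y\<in>reached_heights h H i. y > 2.01" if run: "reduce_fastest_run x 2 h H" for H
    proof -
      obtain c where "reduce_fastest x 2 h H c"
        using reduce_fastest_run_locale[OF run] pos by blast
      moreover have "h 2 < h 1" "h 1 \<ge> x" by (auto simp: h_def)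
      ultimately have "\<exists>y\<in>reached_heights h H 2. y > 2.01"
        using reduce_fastest.starvation[of x 2 h H c 2 1 "2.01"] by simp
      then show ?thesis by (rule bexI) simp
    qed
    with pos sum show ?thesis by blast
  next
    case 2
    \<comment> \<open>This is \<open>m = k = 10\<close> and \<open>p = 19\<close>, with
      \<open>b\<close> fixed by the total rate 1. The height \<open>48 * b\<close> decreases in
      \<open>x\<close> and is still about 2.02 at \<open>x = 1.1\<close>.\<close>
    define a b where "a = x / 19" and "b = 1 / 10 - x / 19"
    define h where "h i = (if i \<le> 10 then a else b)" for i :: nat
    have ab: "b < a" "0 < b"
      using 2 by (auto simp: a_def b_def)
    then have pos: "h i > 0" for i
      by (simp add: h_def)
    have "(\<Sum>i=1..20. h i) = (\<Sum>i=1..10. h i) + (\<Sum>i=11..20. h i)"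
      by (subst sum.union_disjoint[symmetric]) (auto intro!: sum.cong)
    also have "\<dots> = 1"
      by (simp add: h_def a_def b_def)
    finally have sum: "(\<Sum>i=1..20. h i) = 1" .
    have "\<exists>i\<in>{1..20}. \<exists>y\<in>reached_heights h H i. y > 2.01"
      if run: "reduce_fastest_run x 20 h H" for H
    proof -
      obtain c where "reduce_fastest x 20 h H c"
        using reduce_fastest_run_locale[OF run] pos by blast
      then have "\<exists>i\<in>{1..20}. (2 * real 19 + real 10) * b \<in> reached_heights h H i"
        by (rule reduce_fastest.two_rates[where k = 10 and a = a])
          (use ab in \<open>auto simp: h_def a_def\<close>)
      moreover have "(2 * real 19 + real 10) * b > 2.01"
        using 2 by (simp add: b_def)
      ultimately show ?thesis by blast
    qed
    with pos sum show ?thesis by blast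
  next
    case 3
    \<comment> \<open>Twenty bamboos suffice, since \<open>1.1 + 1 - 1 / 20 = 2.05\<close>.\<close>
    define h :: "nat \<Rightarrow> real" where "h i = 1 / 20" for i
    have pos: "h i > 0" for i by (simp add: h_def)
    have sum: "(\<Sum>i=1..20. h i) = 1" by (simp add: h_def)
    have "\<exists>i\<in>{1..20}. \<exists>y\<in>reached_heights h H i. y > 2.01"
      if run: "reduce_fastest_run x 20 h H" for H
    proof -
      obtain c where "reduce_fastest x 20 h H c"
        using reduce_fastest_run_locale[OF run] pos by blast
      then have "\<exists>i\<in>{1..20}. \<exists>y\<in>reached_heights h H i. y \<ge> x + 1 - 1 / real 20"
        by (rule reduce_fastest.equal_rates) (use 3 in \<open>auto simp: h_def\<close>)
      moreover have "x + 1 - 1 / real 20 > 2.01"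
        using 3 by simp
      ultimately show ?thesis by (meson less_le_trans)
    qed
    with pos sum show ?thesis by blast
  qed
qed

end
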